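(* Let $c\in[0,1]$ and consider the discrete dynamical system $$\delta(s+1)=\theta(s)\,\delta(s),\qquad \theta(s+1)=\theta(s)+c\,(1-\theta(s))\,\delta(s)\,\theta(s),\qquad s=0,1,2,\ldots$$ defined on the extended domain $\mathcal{D}^e=\{(\delta,\theta) : \delta\in[0,1],\ \theta\in[0,1)\}$. If the initial condition $(\delta(0),\theta(0))\in\mathcal{D}^e$ satisfies $$c\,\delta(0)+\theta(0)<1,$$ then the system converges to consensus, i.e. $\delta(s)\to 0$ as $s\to\infty$.
   Context: The system models a single agent with stubbornness $\theta(s)$ opposed to a very large group of agents sharing one opinion, over a sequence of issues $s=0,1,2,\ldots$; $\delta(s)$ is the distance of the single agent's opinion from the median opinion at the start of issue $s$, and $c$ is the stubbornness-update gain. In this setting "consensus" means $\delta(s)\to0$ as $s\to\infty$. *)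

theory Defs
  imports Complex_Main
begin

definition extended_domain :: "(real \<times> real) set" where
  "extended_domain = {(\<delta>, \<theta>). \<delta> \<in> {0..1} \<and> \<theta> \<in> {0..<1}}"

text \<open>
  Only the recursion is imposed here; membership of the trajectory in the extended domain is
  required at the initial time only, where it is a hypothesis on the initial condition.
\<close>

definition is_trajectory :: "real \<Rightarrow> (nat \<Rightarrow> real) \<Rightarrow> (nat \<Rightarrow> real) \<Rightarrow> bool" where
  "is_trajectory c \<delta> \<theta> \<longleftrightarrow>
     (\<forall>s. \<delta> (Suc s) = \<theta> s * \<delta> s \<and>
          \<theta> (Suc s) = \<theta> s + c * (1 - \<theta> s) * \<delta> s * \<theta> s)"

definition converges_to_consensus :: "(nat \<Rightarrow> real) \<Rightarrow> bool" where
  "converges_to_consensus \<delta> \<longleftrightarrow> \<delta> \<longlonglongrightarrow> 0"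

end

(* The function V = c * delta + theta decreases along trajectories, by c * delta * (1 - theta)^2
   at each step. Hence theta never exceeds V(0) < 1, and delta decays geometrically with
   ratio V(0). *)
theory Submission
  imports Defs
begin

text \<open>The terms in \<open>c * d\<close> on the left have total coefficient 2t - t^2, which is
  1 - (1 - t)^2.\<close>

lemma lyapunov_step:
  fixes c d t :: real
  shows "c * (t * d) + (t + c * (1 - t) * d * t) = (c * d + t) - c * d * (1 - t)\<^sup>2"
  by (simp add: power2_eq_square algebra_simps)

text \<open>The bounds are proved jointly because they feed each other: the signs make the loss in V
  nonnegative, and the bound on V controls \<open>\<theta> s\<close>, which is both the sign of 1 -
  \<open>\<theta> s\<close> and the contraction factor of \<open>\<delta>\<close>.\<close>

lemma trajectory_bounds:
  fixes c :: real and \<delta> \<theta> :: "nat \<Rightarrow> real"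
  assumes c: "0 \<le> c"
    and traj: "is_trajectory c \<delta> \<theta>"
    and init: "0 \<le> \<delta> 0" "0 \<le> \<theta> 0"
    and V0: "c * \<delta> 0 + \<theta> 0 \<le> 1"
  shows "0 \<le> \<theta> s \<and> c * \<delta> s + \<theta> s \<le> c * \<delta> 0 + \<theta> 0 \<and>
    0 \<le> \<delta> s \<and> \<delta> s \<le> (c * \<delta> 0 + \<theta> 0) ^ s * \<delta> 0"
proof (induction s)
  case 0
  then show ?case using init by simp
next
  case (Suc s)
  let ?V = "c * \<delta> 0 + \<theta> 0"
  have step: "\<delta> (Suc s) = \<theta> s * \<delta> s"
    "\<theta> (Suc s) = \<theta> s + c * (1 - \<theta> s) * \<delta> s * \<theta> s"
    using traj by (auto simp: is_trajectory_def)
  have nonneg: "0 \<le> \<theta> s" "0 \<le> \<delta> s" "0 \<le> c * \<delta> s"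
    using Suc c by auto
  \<comment> \<open>Drop the nonnegative term \<open>c * \<delta> s\<close> from the bound on
    V.\<close>
  then have le: "\<theta> s \<le> ?V" "\<theta> s \<le> 1"
    using Suc V0 by linarith+
  have "0 \<le> \<theta> (Suc s)"
    unfolding step using nonneg le c by simp
  moreover have "c * \<delta> (Suc s) + \<theta> (Suc s) \<le> ?V"
    unfolding step lyapunov_step using Suc mult_nonneg_nonneg[OF nonneg(3) zero_le_power2]
    by (smt (verit))
  moreover have "\<delta> (Suc s) \<le> ?V ^ Suc s * \<delta> 0"
    unfolding step using mult_mono[of "\<theta> s" ?V "\<delta> s" "?V ^ s * \<delta> 0"] le nonneg Suc
    by (simp add: mult.assoc)
  ultimately show ?case
    using nonneg step by simp
qed

theorem mainTheorem2:
  fixes c :: real and \<delta> \<theta> :: "nat \<Rightarrow> real"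
  assumes "c \<in> {0..1}"
    and "is_trajectory c \<delta> \<theta>"
    and "(\<delta> 0, \<theta> 0) \<in> extended_domain"
    and "c * \<delta> 0 + \<theta> 0 < 1"
  shows "converges_to_consensus \<delta>"
proof -
  let ?V = "c * \<delta> 0 + \<theta> 0"
  have init: "0 \<le> c" "0 \<le> \<delta> 0" "0 \<le> \<theta> 0"
    using assms(1,3) by (auto simp: extended_domain_def)
  note bounds = trajectory_bounds[OF init(1) assms(2) init(2,3) less_imp_le[OF assms(4)]]
  \<comment> \<open>The strict inequality V(0) < 1 enters here; the invariants above only used V(0)
    \<le> 1.\<close>
  have "(\<lambda>s. ?V ^ s) \<longlonglongrightarrow> 0"
    using init assms(4) by (intro LIMSEQ_realpow_zero) auto
  then have lim: "(\<lambda>s. ?V ^ s * \<delta> 0) \<longlonglongrightarrow> 0"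
    by (rule tendsto_mult_left_zero)
  have "\<delta> \<longlonglongrightarrow> 0"
    by (rule tendsto_sandwich[OF _ _ tendsto_const lim]) (use bounds in auto)
  then show ?thesis
    by (simp add: converges_to_consensus_def)
qed

end
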